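(* Suppose that the confidence levels satisfy $\sum_{t=0}^\infty\beta_t^{(i)}<\infty$ for all components $i$, and let $\bar{\mathcal{Z}}=\bar{\mathcal{X}}\times\mathcal{S}\times\mathcal{I}\times W\subseteq\operatorname{dom}\hat V_N$ be a robust positive invariant set for the closed-loop system $z_{t+1}=\tilde f(z_t,\hat\kappa_N(z_t),w_{t+1})$, where $\bar{\mathcal{X}}\subseteq\mathbb{R}^{n_x}$ is a compact set containing the origin. Assume furthermore that: (i) $\mathcal{T}\hat V_f\le\hat V_f$; (ii) for some $c>0$, $c\|x\|^2\le\ell(x,u,w)$ for all $z=(x,s,\beta,w)\in\operatorname{dom}\hat V_N$ and all $u\in\hat{\mathcal{U}}(z)$; (iii) $\hat V_N$ is locally bounded in $\bar{\mathcal{Z}}$. Then the origin is mean-square stable for the MPC-controlled closed-loop system $z_{t+1}=\tilde f(z_t,\hat\kappa_N(z_t),w_{t+1})$ for all initial states $z_0\in\bar{\mathcal{Z}}$, i.e., $\lim_{t\to\infty}\mathbb{E}[\|x_t\|^2]=0$ for all $z_0\in\bar{\mathcal{Z}}$, where $(z_t)_{t\in\mathbb{N}}=(x_t,s_t,\beta_t,w_t)_{t\in\mathbb{N}}$ is the closed-loop process started at $z_0$.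
   Context: System: $x_{t+1}=f(x_t,u_t,w_{t+1})$ with $x_t\in\mathbb{R}^{n_x}$, $u_t\in\mathbb{R}^{n_u}$, and $(w_t)_{t\in\mathbb{N}}$ a time-homogeneous Markov chain on $W=\{1,\dots,d\}$, defined on $(\Omega,\mathcal{F},\mathbb{P})$, with (unknown) transition matrix $P$ whose $w$-th row is $P_w$, and known (deterministic) initial mode. Expectations are with respect to $\mathbb{P}$. $\Delta_d$ is the probability simplex in $\mathbb{R}^d$. Learning system: learner states $s_t\in\mathcal{S}\subseteq\mathbb{R}^{n_s}$, a statistic of the observed modes up to time $t$, with update $s_{t+1}=\mathcal{L}(s_t,w_t,w_{t+1})$; confidence vectors $\beta_t\in\mathcal{I}=[0,1]^{n_\beta}$, $n_\beta=n_g+1$, with deterministic update $\beta_{t+1}=C(\beta_t)$; components of $\beta$ are denoted $\beta^{(0)}$ (for the cost) and $\beta^{(1)},\dots,\beta^{(n_g)}$ (for the constraints). Ambiguity sets $\mathcal{A}_b(s,w)\subseteq\Delta_d$ are convex subsets, for $s\in\mathcal{S}$, $w\in W$, $b\in[0,1]$, such that for all $t\in\mathbb{N}$ and all components $i$, $$\mathbb{P}[P_{w_t}\in\mathcal{A}_{\beta_t^{(i)}}(s_t,w_t)]\ge1-\beta_t^{(i)}.$$ This coverage property and the summability of the confidence levels are assumed to hold for the sequences $(s_t)$, $(\beta_t)$ generated along the process started at the initial state $z_0$ under consideration. Augmented state $z=(x,s,\beta,w)\in\mathcal{Z}=\mathbb{R}^{n_x}\times\mathcal{S}\times\mathcal{I}\times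 W$ with dynamics $\tilde f(z,u,v)=(f(x,u,v),\mathcal{L}(s,w,v),C(\beta),v)$. Risk measures: for $\xi:W\to\overline{\mathbb{R}}$, $\rho_{s,w,b}[\xi(v)]=\max_{p\in\mathcal{A}_b(s,w)}\sum_{v\in W}p_v\xi(v)$, where the value is $+\infty$ as soon as $\xi(v)=+\infty$ for some $v\in W$. For $\hat\alpha\in[0,1]$, $\bar\rho^{\,\hat\alpha}_{s,w,b}[\xi(v)]=\max_{p\in\mathcal{A}_b(s,w)}\mathrm{AV@R}^p_{\hat\alpha}[\xi(v)]$, with $\mathrm{AV@R}^p_{\hat\alpha}[\xi(v)]=\min_{t\in\mathbb{R}}t+\frac1{\hat\alpha}\sum_v p_v\max\{\xi(v)-t,0\}$ if $\hat\alpha\ne0$, and $\max_{v\in W}\xi(v)$ if $\hat\alpha=0$. Feasible inputs: given constraint functions $g_i:\mathbb{R}^{n_x}\times\mathbb{R}^{n_u}\times W^2\to\mathbb{R}$ and parameters $\hat\alpha_i\in[0,1]$ (possibly depending on $\beta^{(i)}$), $\hat{\mathcal{U}}(z)=\{u:\bar\rho^{\,\hat\alpha_i}_{s,w,\beta^{(i)}}[g_i(x,u,w,v)]\le0,\ i=1,\dots,n_g\}$. Optimal control problem of horizon $N\in\mathbb{N}_{>0}$: given a stage cost $\ell:\mathbb{R}^{n_x}\times\mathbb{R}^{n_u}\times W\to\mathbb{R}_+$ and a terminal cost $\hat V_f:\mathcal{Z}\to\overline{\mathbb{R}}_+$, $\hat V_f(x,s,\beta,w)=V_f(x,w)+\delta_{\hat{\mathcal{X}}_f}(x,s,\beta)$,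 with $V_f\ge0$ real-valued, $\hat{\mathcal{X}}_f$ a terminal set, and $\delta$ the characteristic function ($0$ on the set, $+\infty$ outside), the Bellman operator is $$\mathcal{T}(\hat V)(z)=\min_{u\in\hat{\mathcal{U}}(z)}\ell(x,u,w)+\rho_{s,w,\beta^{(0)}}[\hat V(\tilde f(z,u,v))]$$ ($+\infty$ if infeasible), and the optimal cost $\hat V_N$ is given by $\hat V_0=\hat V_f$, $\hat V_k=\mathcal{T}\hat V_{k-1}$ for $k=1,\dots,N$. $\operatorname{dom}\hat V_N=\{z:\hat V_N(z)<\infty\}$. For $z\in\operatorname{dom}\hat V_N$, the MPC law $\hat\kappa_N(z)$ is a minimizer in the definition of $\mathcal{T}(\hat V_{N-1})(z)$ (minimizers are assumed to exist). A set $\mathcal{R}\subseteq\mathcal{Z}$ is robust positive invariant for the closed-loop system if for all $z\in\mathcal{R}$, $\tilde f(z,\hat\kappa_N(z),v)\in\mathcal{R}$ for all $v\in W$. *)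

theory Defs
  imports "HOL-Probability.Probability"
begin

text \<open>
  The mode set \<open>{1,\<dots>,d}\<close> is a finite type \<open>'d\<close>. A confidence vector \<open>\<beta> :: nat \<Rightarrow> real\<close> is an
  extensional function on \<open>{0..n_con}\<close>, index 0 belonging to the cost and \<open>1,\<dots>,n_con\<close> to the
  constraints (so that \<open>n_con = 0\<close> is allowed).
\<close>

type_synonym ('nx, 'ns, 'd) aug = "(real^'nx) \<times> (real^'ns) \<times> (nat \<Rightarrow> real) \<times> 'd"

record ('nx, 'nu, 'ns, 'd) mpc_data =
  sys_dyn :: "real^('nx::finite) \<Rightarrow> real^('nu::finite) \<Rightarrow> ('d::finite) \<Rightarrow> real^'nx"
  learner_states :: "(real^('ns::finite)) set"
  learner :: "real^('ns::finite) \<Rightarrow> ('d::finite) \<Rightarrow> 'd \<Rightarrow> real^'ns"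
  conf_dyn :: "(nat \<Rightarrow> real) \<Rightarrow> nat \<Rightarrow> real"
  n_con :: nat
  amb :: "real \<Rightarrow> real^('ns::finite) \<Rightarrow> ('d::finite) \<Rightarrow> (real^'d) set"
  con_fun :: "nat \<Rightarrow> real^('nx::finite) \<Rightarrow> real^('nu::finite) \<Rightarrow> ('d::finite) \<Rightarrow> 'd \<Rightarrow> real"
  risk_par :: "nat \<Rightarrow> real \<Rightarrow> real"
  stage_cost :: "real^('nx::finite) \<Rightarrow> real^('nu::finite) \<Rightarrow> ('d::finite) \<Rightarrow> real"
  term_cost :: "real^('nx::finite) \<Rightarrow> ('d::finite) \<Rightarrow> real"
  term_set :: "((real^('nx::finite)) \<times> (real^('ns::finite)) \<times> (nat \<Rightarrow> real)) set"

definition prob_simplex :: "(real^('d::finite)) set" where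
  "prob_simplex = {p. (\<forall>v. 0 \<le> p $ v) \<and> (\<Sum>v\<in>UNIV. p $ v) = 1}"

definition conf_set :: "('nx::finite, 'nu::finite, 'ns::finite, 'd::finite) mpc_data \<Rightarrow> (nat \<Rightarrow> real) set" where
  "conf_set D = {0..n_con D} \<rightarrow>\<^sub>E {0..1}"

definition aug_space ::
  "('nx::finite, 'nu::finite, 'ns::finite, 'd::finite) mpc_data \<Rightarrow> ('nx, 'ns, 'd) aug set" where
  "aug_space D = UNIV \<times> learner_states D \<times> conf_set D \<times> UNIV"

definition wf_mpc :: "('nx::finite, 'nu::finite, 'ns::finite, 'd::finite) mpc_data \<Rightarrow> bool" where
  "wf_mpc D \<longleftrightarrow>
     (\<forall>s\<in>learner_states D. \<forall>w v. learner D s w v \<in> learner_states D) \<and>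
     conf_dyn D \<in> conf_set D \<rightarrow> conf_set D \<and>
     (\<forall>b\<in>{0..1}. \<forall>s\<in>learner_states D. \<forall>w.
        amb D b s w \<noteq> {} \<and> convex (amb D b s w) \<and> amb D b s w \<subseteq> prob_simplex) \<and>
     (\<forall>i\<in>{1..n_con D}. \<forall>b\<in>{0..1}. risk_par D i b \<in> {0..1}) \<and>
     (\<forall>x u w. 0 \<le> stage_cost D x u w) \<and>
     (\<forall>x w. 0 \<le> term_cost D x w)"

fun aug_dyn :: "('nx::finite, 'nu::finite, 'ns::finite, 'd::finite) mpc_data \<Rightarrow>
    ('nx, 'ns, 'd) aug \<Rightarrow> real^'nu \<Rightarrow> 'd \<Rightarrow> ('nx, 'ns, 'd) aug" where
  "aug_dyn D (x, s, \<beta>, w) u v = (sys_dyn D x u v, learner D s w v, conf_dyn D \<beta>, v)"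

text \<open>
  Maxima over ambiguity sets and minima over inputs are suprema and infima in the extended reals,
  which agree with them whenever they are attained; in particular the infimum over an empty set of
  inputs is \<open>\<infinity>\<close>. The case distinction in \<open>risk\<close> is needed since \<open>0 * \<infinity> = 0\<close> in \<open>ereal\<close>.
\<close>

definition risk :: "(real^('d::finite)) set \<Rightarrow> ('d \<Rightarrow> ereal) \<Rightarrow> ereal" where
  "risk A \<xi> = (if \<exists>v. \<xi> v = \<infinity> then \<infinity> else (SUP p\<in>A. \<Sum>v\<in>UNIV. ereal (p $ v) * \<xi> v))"

definition avar :: "real \<Rightarrow> real^('d::finite) \<Rightarrow> ('d \<Rightarrow> real) \<Rightarrow> ereal" where
  "avar \<alpha> p \<xi> =
     (if \<alpha> = 0 then ereal (Max (range \<xi>))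
      else (INF t. ereal (t + 1 / \<alpha> * (\<Sum>v\<in>UNIV. p $ v * max (\<xi> v - t) 0))))"

definition avar_risk :: "real \<Rightarrow> (real^('d::finite)) set \<Rightarrow> ('d \<Rightarrow> real) \<Rightarrow> ereal" where
  "avar_risk \<alpha> A \<xi> = (SUP p\<in>A. avar \<alpha> p \<xi>)"

fun feasible_inputs :: "('nx::finite, 'nu::finite, 'ns::finite, 'd::finite) mpc_data \<Rightarrow>
    ('nx, 'ns, 'd) aug \<Rightarrow> (real^'nu) set" where
  "feasible_inputs D (x, s, \<beta>, w) =
     {u. \<forall>i\<in>{1..n_con D}. avar_risk (risk_par D i (\<beta> i)) (amb D (\<beta> i) s w) (con_fun D i x u w) \<le> 0}"

fun bellman_cost :: "('nx::finite, 'nu::finite, 'ns::finite, 'd::finite) mpc_data \<Rightarrow>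
    (('nx, 'ns, 'd) aug \<Rightarrow> ereal) \<Rightarrow> ('nx, 'ns, 'd) aug \<Rightarrow> real^'nu \<Rightarrow> ereal" where
  "bellman_cost D V (x, s, \<beta>, w) u =
     ereal (stage_cost D x u w) + risk (amb D (\<beta> 0) s w) (\<lambda>v. V (aug_dyn D (x, s, \<beta>, w) u v))"

definition bellman :: "('nx::finite, 'nu::finite, 'ns::finite, 'd::finite) mpc_data \<Rightarrow>
    (('nx, 'ns, 'd) aug \<Rightarrow> ereal) \<Rightarrow> ('nx, 'ns, 'd) aug \<Rightarrow> ereal" where
  "bellman D V z = (INF u\<in>feasible_inputs D z. bellman_cost D V z u)"

fun terminal_value :: "('nx::finite, 'nu::finite, 'ns::finite, 'd::finite) mpc_data \<Rightarrow>
    ('nx, 'ns, 'd) aug \<Rightarrow> ereal" where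
  "terminal_value D (x, s, \<beta>, w) =
     ereal (term_cost D x w) + (if (x, s, \<beta>) \<in> term_set D then 0 else \<infinity>)"

definition opt_value :: "('nx::finite, 'nu::finite, 'ns::finite, 'd::finite) mpc_data \<Rightarrow> nat \<Rightarrow>
    ('nx, 'ns, 'd) aug \<Rightarrow> ereal" where
  "opt_value D k = (bellman D ^^ k) (terminal_value D)"

definition opt_dom :: "('nx::finite, 'nu::finite, 'ns::finite, 'd::finite) mpc_data \<Rightarrow> nat \<Rightarrow>
    ('nx, 'ns, 'd) aug set" where
  "opt_dom D k = {z \<in> aug_space D. opt_value D k z < \<infinity>}"

definition mpc_law :: "('nx::finite, 'nu::finite, 'ns::finite, 'd::finite) mpc_data \<Rightarrow> nat \<Rightarrow>
    (('nx, 'ns, 'd) aug \<Rightarrow> real^'nu) \<Rightarrow> bool" where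
  "mpc_law D N \<kappa> \<longleftrightarrow>
     (\<forall>z\<in>opt_dom D N.
        is_arg_min (bellman_cost D (opt_value D (N - 1)) z) (\<lambda>u. u \<in> feasible_inputs D z) (\<kappa> z))"

definition robust_pos_invariant :: "('nx::finite, 'nu::finite, 'ns::finite, 'd::finite) mpc_data \<Rightarrow>
    (('nx, 'ns, 'd) aug \<Rightarrow> real^'nu) \<Rightarrow> ('nx, 'ns, 'd) aug set \<Rightarrow> bool" where
  "robust_pos_invariant D \<kappa> R \<longleftrightarrow> (\<forall>z\<in>R. \<forall>v. aug_dyn D z (\<kappa> z) v \<in> R)"

definition aug_topology :: "('nx::finite, 'ns::finite, 'd::finite) aug topology" where
  "aug_topology = prod_topology euclidean
     (prod_topology euclidean (prod_topology euclidean (discrete_topology UNIV)))"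

definition locally_bounded_on :: "'z topology \<Rightarrow> 'z set \<Rightarrow> ('z \<Rightarrow> ereal) \<Rightarrow> bool" where
  "locally_bounded_on T S V \<longleftrightarrow>
     (\<forall>z\<in>S. \<exists>U B. openin T U \<and> z \<in> U \<and> (\<forall>y\<in>U \<inter> S. \<bar>V y\<bar> \<le> ereal B))"

definition markov_chain :: "'a measure \<Rightarrow> (nat \<Rightarrow> 'a \<Rightarrow> 'd::finite) \<Rightarrow> real^'d^'d \<Rightarrow> bool" where
  "markov_chain M w P \<longleftrightarrow>
     prob_space M \<and>
     (\<forall>t. w t \<in> measurable M (count_space UNIV)) \<and>
     (\<forall>i. P $ i \<in> prob_simplex) \<and>
     (\<forall>t h v. 0 < measure M {\<omega> \<in> space M. \<forall>k\<le>t. w k \<omega> = h k} \<longrightarrow>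
        cond_prob M (\<lambda>\<omega>. w (Suc t) \<omega> = v) (\<lambda>\<omega>. \<forall>k\<le>t. w k \<omega> = h k) = P $ h t $ v)"

primrec closed_loop :: "('nx::finite, 'nu::finite, 'ns::finite, 'd::finite) mpc_data \<Rightarrow>
    (('nx, 'ns, 'd) aug \<Rightarrow> real^'nu) \<Rightarrow> (nat \<Rightarrow> 'a \<Rightarrow> 'd) \<Rightarrow> ('nx, 'ns, 'd) aug \<Rightarrow>
    nat \<Rightarrow> 'a \<Rightarrow> ('nx, 'ns, 'd) aug" where
  "closed_loop D \<kappa> w z0 0 \<omega> = z0"
| "closed_loop D \<kappa> w z0 (Suc t) \<omega> =
     aug_dyn D (closed_loop D \<kappa> w z0 t \<omega>) (\<kappa> (closed_loop D \<kappa> w z0 t \<omega>)) (w (Suc t) \<omega>)"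

definition coverage :: "('nx::finite, 'nu::finite, 'ns::finite, 'd::finite) mpc_data \<Rightarrow>
    'a measure \<Rightarrow> real^'d^'d \<Rightarrow> (nat \<Rightarrow> nat \<Rightarrow> real) \<Rightarrow> (nat \<Rightarrow> 'a \<Rightarrow> ('nx, 'ns, 'd) aug) \<Rightarrow> bool" where
  "coverage D M P \<beta> Z \<longleftrightarrow>
     (\<forall>t. \<forall>i\<in>{0..n_con D}.
        measure M {\<omega> \<in> space M. case Z t \<omega> of (x, s, b, w) \<Rightarrow> P $ w \<in> amb D (\<beta> t i) s w}
          \<ge> 1 - \<beta> t i)"

end

theory Submission
  imports Defs
begin

text \<open>
  Since the terminal cost is a supersolution, the optimal costs decrease with the horizon, so \<open>V\<^sub>N\<close>
  decreases in conditional mean by at least \<open>c \<parallel>x\<^sub>t\<parallel>\<^sup>2\<close> at every time at which the ambiguity set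
  covers the true transition row. Restricting to the event that coverage holds from time \<open>T\<close> to
  \<open>t\<close>, the expectations of \<open>\<parallel>x\<^sub>t\<parallel>\<^sup>2\<close> are therefore summable in \<open>t\<close>. By a union bound, the
  complement has probability at most the tail \<open>\<Sum>k\<ge>T. \<beta>\<^sub>k\<close>, and there \<open>\<parallel>x\<^sub>t\<parallel>\<close> is
  bounded because \<open>Xbar\<close> is compact. The expectation of \<open>V\<^sub>N(z\<^sub>T)\<close> is finite since \<open>z\<^sub>T\<close> takes only
  finitely many values.
\<close>

section \<open>Order properties of the worst-case expectation and of the Bellman operator\<close>

lemma prob_simplexD:
  assumes "A \<subseteq> prob_simplex" "p \<in> A"
  shows "0 \<le> p $ v"
  using assms by (auto simp: prob_simplex_def)

lemma risk_mono:
  assumes "A \<subseteq> prob_simplex" "\<And>v. \<xi> v \<le> \<zeta> v"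
  shows "risk A \<xi> \<le> risk A \<zeta>"
proof (cases "\<exists>v. \<zeta> v = \<infinity>")
  case False
  then have "\<not> (\<exists>v. \<xi> v = \<infinity>)"
    using assms(2) by (metis ereal_infty_less_eq(1))
  moreover have "(SUP p\<in>A. \<Sum>v\<in>UNIV. ereal (p $ v) * \<xi> v) \<le> (SUP p\<in>A. \<Sum>v\<in>UNIV. ereal (p $ v) * \<zeta> v)"
    using assms prob_simplexD[OF assms(1)]
    by (intro SUP_subset_mono sum_mono ereal_mult_left_mono) auto
  ultimately show ?thesis using False by (simp add: risk_def)
qed (auto simp: risk_def)

lemma risk_nonneg:
  assumes "A \<subseteq> prob_simplex" "A \<noteq> {}" "\<And>v. 0 \<le> \<xi> v"
  shows "0 \<le> risk A \<xi>"
proof -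
  obtain p where p: "p \<in> A" using assms(2) by blast
  have "0 \<le> (\<Sum>v\<in>UNIV. ereal (p $ v) * \<xi> v)"
    using p assms by (intro sum_nonneg ereal_0_le_mult) (auto simp: prob_simplex_def)
  also have "\<dots> \<le> (SUP p\<in>A. \<Sum>v\<in>UNIV. ereal (p $ v) * \<xi> v)"
    using p by (rule SUP_upper)
  finally show ?thesis by (auto simp: risk_def)
qed

lemma risk_upper:
  assumes "p \<in> A" "\<And>v. \<xi> v \<noteq> \<infinity>"
  shows "(\<Sum>v\<in>UNIV. ereal (p $ v) * \<xi> v) \<le> risk A \<xi>"
  using assms by (auto simp: risk_def intro: SUP_upper)

lemma wf_mpc_amb:
  assumes "wf_mpc D" "(x, s, b, w) \<in> aug_space D"
  shows "amb D (b 0) s w \<subseteq> prob_simplex" "amb D (b 0) s w \<noteq> {}"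
proof -
  have "b 0 \<in> {0..1}" "s \<in> learner_states D"
    using assms(2) by (auto simp: aug_space_def conf_set_def PiE_iff)
  with assms(1) show "amb D (b 0) s w \<subseteq> prob_simplex" "amb D (b 0) s w \<noteq> {}"
    unfolding wf_mpc_def by blast+
qed

lemma aug_dyn_aug_space:
  assumes "wf_mpc D" "z \<in> aug_space D"
  shows "aug_dyn D z u v \<in> aug_space D"
  using assms by (cases z) (auto simp: aug_space_def wf_mpc_def)

text \<open>The feasible inputs depend on \<open>z\<close> but not on the value function, so the
  costs are compared input by input. Comparing \<open>V\<close> and \<open>V'\<close> on
  \<open>aug_space D\<close> suffices because successors stay there.\<close>

lemma bellman_mono:
  assumes "wf_mpc D" "\<And>z. z \<in> aug_space D \<Longrightarrow> V z \<le> V' z" "z \<in> aug_space D"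
  shows "bellman D V z \<le> bellman D V' z"
proof -
  obtain x s b w where z: "z = (x, s, b, w)" by (cases z)
  have "bellman_cost D V z u \<le> bellman_cost D V' z u" for u
    unfolding z bellman_cost.simps
    using assms(3) wf_mpc_amb(1)[OF assms(1)] aug_dyn_aug_space[OF assms(1)]
    by (intro add_left_mono risk_mono assms(2)) (auto simp: z simp del: aug_dyn.simps)
  then show ?thesis unfolding bellman_def by (intro INF_mono) auto
qed

lemma bellman_nonneg:
  assumes "wf_mpc D" "\<And>z. z \<in> aug_space D \<Longrightarrow> 0 \<le> V z" "z \<in> aug_space D"
  shows "0 \<le> bellman D V z"
proof -
  obtain x s b w where z: "z = (x, s, b, w)" by (cases z)
  have "0 \<le> bellman_cost D V z u" for u
    unfolding z bellman_cost.simps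
    using assms(1,3) wf_mpc_amb[OF assms(1)] aug_dyn_aug_space[OF assms(1)]
    by (intro add_nonneg_nonneg risk_nonneg assms(2))
      (auto simp: z wf_mpc_def simp del: aug_dyn.simps)
  then show ?thesis unfolding bellman_def by (intro INF_greatest)
qed

section \<open>Optimal costs and their decrease along the MPC law\<close>

lemma opt_value_0: "opt_value D 0 = terminal_value D"
  and opt_value_Suc: "opt_value D (Suc k) = bellman D (opt_value D k)"
  by (simp_all add: opt_value_def)

lemma opt_value_nonneg:
  assumes "wf_mpc D" "z \<in> aug_space D"
  shows "0 \<le> opt_value D k z"
  using assms(2)
proof (induction k arbitrary: z)
  case 0
  then show ?case using assms(1) by (cases z) (auto simp: opt_value_0 wf_mpc_def)
next
  case (Suc k)
  then show ?case using bellman_nonneg[OF assms(1)] by (simp add: opt_value_Suc)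
qed

text \<open>The supersolution property of the terminal cost is the base case; monotonicity of
  \<open>bellman\<close> carries the inequality to every horizon.\<close>

lemma opt_value_Suc_le:
  assumes "wf_mpc D"
    and "\<And>z. z \<in> aug_space D \<Longrightarrow> bellman D (terminal_value D) z \<le> terminal_value D z"
    and "z \<in> aug_space D"
  shows "opt_value D (Suc k) z \<le> opt_value D k z"
  using assms(3)
proof (induction k arbitrary: z)
  case 0
  then show ?case using assms(2) by (simp add: opt_value_0 opt_value_Suc)
next
  case (Suc k)
  then show ?case
    using bellman_mono[OF assms(1)] by (simp add: opt_value_Suc[of _ "Suc k"] opt_value_Suc[of _ k])
qed

text \<open>The minimizer turns the optimal cost into stage cost plus the worst case of the horizon
  \<open>N - 1\<close> cost. That worst case dominates the mean under any \<open>p\<close> in the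
  ambiguity set, and the horizon \<open>N\<close> cost is no larger than the horizon
  \<open>N - 1\<close> cost.\<close>

lemma opt_value_drift:
  assumes wf: "wf_mpc D"
    and decr: "\<And>z. z \<in> aug_space D \<Longrightarrow> bellman D (terminal_value D) z \<le> terminal_value D z"
    and "0 < N" and law: "mpc_law D N \<kappa>"
    and z: "z = (x, s, b, v0)" "z \<in> opt_dom D N"
    and p: "p \<in> amb D (b 0) s v0"
  shows "stage_cost D x (\<kappa> z) v0
      + (\<Sum>v\<in>UNIV. p $ v * real_of_ereal (opt_value D N (aug_dyn D z (\<kappa> z) v)))
    \<le> real_of_ereal (opt_value D N z)"
proof -
  obtain k where k: "N = Suc k" using \<open>0 < N\<close> gr0_implies_Suc by blast
  define zp where "zp v = aug_dyn D z (\<kappa> z) v" for v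
  define R where "R = risk (amb D (b 0) s v0) (\<lambda>v. opt_value D k (zp v))"
  have zA: "z \<in> aug_space D" and fin: "opt_value D N z < \<infinity>"
    using z(2) by (auto simp: opt_dom_def)
  have zpA: "zp v \<in> aug_space D" for v
    unfolding zp_def by (rule aug_dyn_aug_space[OF wf zA])
  have amin: "is_arg_min (bellman_cost D (opt_value D k) z) (\<lambda>u. u \<in> feasible_inputs D z) (\<kappa> z)"
    using law z(2) by (auto simp: mpc_law_def k)
  have "opt_value D N z = bellman_cost D (opt_value D k) z (\<kappa> z)"
    unfolding k opt_value_Suc bellman_def
    using amin by (intro INF_eqI) (auto simp: is_arg_min_linorder)
  then have VN: "opt_value D N z = ereal (stage_cost D x (\<kappa> z) v0) + R"
    by (simp add: z(1) R_def zp_def del: aug_dyn.simps)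
  have R0: "0 \<le> R"
    unfolding R_def using wf_mpc_amb[OF wf] zA z(1)
    by (intro risk_nonneg opt_value_nonneg[OF wf zpA]) auto
  have Rfin: "R \<noteq> \<infinity>" using fin VN by auto
  \<comment> \<open>A single infinite successor value makes \<open>risk\<close> infinite, even at a
    mode of probability zero. Hence a finite risk forces all successor values to be finite, which
    permits the passage from \<open>ereal\<close> to reals.\<close>
  then have kfin: "opt_value D k (zp v) \<noteq> \<infinity>" for v
    unfolding R_def risk_def by (metis (mono_tags, lifting))
  have le: "opt_value D N (zp v) \<le> opt_value D k (zp v)" for v
    unfolding k by (rule opt_value_Suc_le[OF wf decr zpA])
  have real: "ereal (real_of_ereal (opt_value D N (zp v))) = opt_value D N (zp v)" for v
    using kfin[of v] le[of v] opt_value_nonneg[OF wf zpA, of N v] by (cases "opt_value D N (zp v)") auto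
  have pn: "0 \<le> p $ v" for v
    using prob_simplexD[OF wf_mpc_amb(1)[OF wf zA[unfolded z(1)]] p] .
  have "ereal (\<Sum>v\<in>UNIV. p $ v * real_of_ereal (opt_value D N (zp v)))
      = (\<Sum>v\<in>UNIV. ereal (p $ v) * opt_value D N (zp v))"
    by (simp only: flip: sum_ereal times_ereal.simps(1)) (simp only: real)
  also have "\<dots> \<le> (\<Sum>v\<in>UNIV. ereal (p $ v) * opt_value D k (zp v))"
    using le pn by (intro sum_mono ereal_mult_left_mono) auto
  also have "\<dots> \<le> R"
    unfolding R_def using p kfin by (rule risk_upper)
  finally have "ereal (\<Sum>v\<in>UNIV. p $ v * real_of_ereal (opt_value D N (zp v))) \<le> R" .
  then show ?thesis
    using R0 Rfin unfolding VN zp_def by (cases R) auto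
qed

section \<open>Functionals of finite mode histories\<close>

lemma measurable_history:
  fixes F :: "(nat \<Rightarrow> 'd::finite) \<Rightarrow> 'b"
  assumes meas: "\<And>k. w k \<in> measurable M (count_space UNIV)"
    and F: "\<And>h h'. (\<And>k. k \<le> t \<Longrightarrow> h k = h' k) \<Longrightarrow> F h = F h'"
  shows "(\<lambda>\<omega>. F (\<lambda>k. w k \<omega>)) \<in> measurable M (count_space UNIV)"
proof -
  note meas[measurable]
  define H where "H = {..t} \<rightarrow>\<^sub>E (UNIV :: 'd set)"
  define r where "r \<omega> = restrict (\<lambda>k. w k \<omega>) {..t}" for \<omega>
  have "r -` {h} \<inter> space M \<in> sets M" if "h \<in> H" for h
  proof -
    have "r -` {h} \<inter> space M = {\<omega> \<in> space M. \<forall>k\<in>{..t}. w k \<omega> = h k}"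
      using that by (auto simp: r_def H_def fun_eq_iff PiE_iff extensional_def)
    also have "\<dots> \<in> sets M"
      by measurable
    finally show ?thesis .
  qed
  then have r: "r \<in> measurable M (count_space H)"
    by (subst measurable_count_space_eq2) (auto simp: H_def r_def intro: finite_PiE)
  \<comment> \<open>\<open>F\<close> itself may be arbitrary: it factors through \<open>r\<close>,
    which takes values in the finite set \<open>H\<close> with the discrete sigma-algebra.\<close>
  have "(\<lambda>\<omega>. F (r \<omega>)) \<in> measurable M (count_space UNIV)"
    by (rule measurable_compose[OF r]) simp
  moreover have "F (r \<omega>) = F (\<lambda>k. w k \<omega>)" for \<omega>
    by (rule F) (simp add: r_def)
  ultimately show ?thesis by simp
qed

text \<open>Finitely many histories give finitely many values, so \<open>F\<close> is bounded, for
  instance by the sum of the absolute values in its range.\<close>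

lemma integrable_history:
  fixes F :: "(nat \<Rightarrow> 'd::finite) \<Rightarrow> real"
  assumes "prob_space M"
    and meas: "\<And>k. w k \<in> measurable M (count_space UNIV)"
    and F: "\<And>h h'. (\<And>k. k \<le> t \<Longrightarrow> h k = h' k) \<Longrightarrow> F h = F h'"
  shows "integrable M (\<lambda>\<omega>. F (\<lambda>k. w k \<omega>))"
proof -
  interpret prob_space M by fact
  define H where "H = {..t} \<rightarrow>\<^sub>E (UNIV :: 'd set)"
  have fin: "finite (F ` H)" by (simp add: H_def finite_PiE)
  have "F (\<lambda>k. w k \<omega>) \<in> F ` H" for \<omega>
    using F[of "\<lambda>k. w k \<omega>" "restrict (\<lambda>k. w k \<omega>) {..t}"] by (auto simp: H_def)
  then have "norm (F (\<lambda>k. w k \<omega>)) \<le> (\<Sum>y\<in>F ` H. \<bar>y\<bar>)" for \<omega>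
    using fin member_le_sum[where f=abs and A="F ` H" and i="F (\<lambda>k. w k \<omega>)"] by auto
  moreover have "(\<lambda>\<omega>. F (\<lambda>k. w k \<omega>)) \<in> borel_measurable M"
    by (rule measurable_compose[OF measurable_history[OF meas F, of t]]) simp_all
  ultimately show ?thesis
    by (intro integrable_const_bound) auto
qed

text \<open>This is the Markov property tested against a function of the past, in place of a
  conditional expectation. It follows by summing over the finitely many cylinder events
  \<open>C h\<close>.\<close>

lemma markov_chain_history:
  fixes F :: "(nat \<Rightarrow> 'd::finite) \<Rightarrow> real"
  assumes mc: "markov_chain M w P"
    and F: "\<And>h h'. (\<And>k. k \<le> t \<Longrightarrow> h k = h' k) \<Longrightarrow> F h = F h'"
  shows "(\<integral>\<omega>. F (\<lambda>k. w k \<omega>) * of_bool (w (Suc t) \<omega> = v) \<partial>M)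
    = (\<integral>\<omega>. F (\<lambda>k. w k \<omega>) * P $ w t \<omega> $ v \<partial>M)"
proof -
  interpret prob_space M using mc by (simp add: markov_chain_def)
  have meas[measurable]: "w k \<in> measurable M (count_space UNIV)" for k
    using mc by (simp add: markov_chain_def)
  define H where "H = {..t} \<rightarrow>\<^sub>E (UNIV :: 'd set)"
  define C where "C h = {\<omega> \<in> space M. \<forall>k\<in>{..t}. w k \<omega> = h k}" for h
  define E where "E = {\<omega> \<in> space M. w (Suc t) \<omega> = v}"
  have finH: "finite H" by (simp add: H_def finite_PiE)
  have C[measurable]: "C h \<in> sets M" for h unfolding C_def by measurable
  have E[measurable]: "E \<in> sets M" unfolding E_def by measurable
  have split: "F (\<lambda>k. w k \<omega>) * g = (\<Sum>h\<in>H. indicator (C h) \<omega> * (F h * g))"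
    if "\<omega> \<in> space M" for \<omega> g
  proof -
    define r where "r = restrict (\<lambda>k. w k \<omega>) {..t}"
    have "indicator (C h) \<omega> = (of_bool (h = r) :: real)" if "h \<in> H" for h
      using that \<open>\<omega> \<in> space M\<close>
      by (auto simp: r_def C_def H_def fun_eq_iff PiE_iff extensional_def indicator_def Bex_def)
    then have "(\<Sum>h\<in>H. indicator (C h) \<omega> * (F h * g)) = (\<Sum>h\<in>H. if h = r then F h * g else 0)"
      by (intro sum.cong) auto
    also have "\<dots> = F r * g"
      using finH by (simp add: sum.delta) (simp add: r_def H_def)
    also have "F r = F (\<lambda>k. w k \<omega>)" by (rule F) (simp add: r_def)
    finally show ?thesis by simp
  qed
  \<comment> \<open>The definition of \<open>markov_chain\<close> speaks only of histories of
    positive probability; on null histories both sides vanish.\<close>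
  have step: "measure M (C h \<inter> E) = P $ h t $ v * measure M (C h)" for h
  proof (cases "measure M (C h) = 0")
    case True
    moreover have "measure M (C h \<inter> E) \<le> measure M (C h)"
      by (intro finite_measure_mono) auto
    ultimately show ?thesis by (simp add: measure_le_0_iff)
  next
    case False
    then have pos: "0 < measure M {\<omega> \<in> space M. \<forall>k\<le>t. w k \<omega> = h k}"
      by (simp add: C_def zero_less_measure_iff Ball_def)
    then have "cond_prob M (\<lambda>\<omega>. w (Suc t) \<omega> = v) (\<lambda>\<omega>. \<forall>k\<le>t. w k \<omega> = h k) = P $ h t $ v"
      using mc by (simp add: markov_chain_def)
    moreover have "{\<omega> \<in> space M. w (Suc t) \<omega> = v \<and> (\<forall>k\<le>t. w k \<omega> = h k)} = C h \<inter> E"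
      by (auto simp: C_def E_def)
    ultimately show ?thesis using pos
      by (simp add: cond_prob_def C_def Ball_def field_simps)
  qed
  have "(\<integral>\<omega>. F (\<lambda>k. w k \<omega>) * of_bool (w (Suc t) \<omega> = v) \<partial>M)
      = (\<integral>\<omega>. (\<Sum>h\<in>H. indicator (C h \<inter> E) \<omega> * F h) \<partial>M)"
  proof (intro Bochner_Integration.integral_cong refl)
    fix \<omega> assume "\<omega> \<in> space M"
    then show "F (\<lambda>k. w k \<omega>) * of_bool (w (Suc t) \<omega> = v) = (\<Sum>h\<in>H. indicator (C h \<inter> E) \<omega> * F h)"
      unfolding split[OF \<open>\<omega> \<in> space M\<close>]
      by (intro sum.cong) (auto simp: E_def indicator_def)
  qed
  also have "\<dots> = (\<Sum>h\<in>H. measure M (C h \<inter> E) * F h)"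
    by (subst Bochner_Integration.integral_sum) (auto intro!: integrable_mult_left simp: emeasure_eq_measure)
  also have "\<dots> = (\<Sum>h\<in>H. measure M (C h) * (F h * P $ h t $ v))"
    by (simp add: step mult_ac)
  also have "\<dots> = (\<integral>\<omega>. (\<Sum>h\<in>H. indicator (C h) \<omega> * (F h * P $ h t $ v)) \<partial>M)"
    by (subst Bochner_Integration.integral_sum) (auto intro!: integrable_mult_left simp: emeasure_eq_measure)
  also have "\<dots> = (\<integral>\<omega>. F (\<lambda>k. w k \<omega>) * P $ w t \<omega> $ v \<partial>M)"
  proof (intro Bochner_Integration.integral_cong refl)
    fix \<omega> assume "\<omega> \<in> space M"
    then show "(\<Sum>h\<in>H. indicator (C h) \<omega> * (F h * P $ h t $ v)) = F (\<lambda>k. w k \<omega>) * P $ w t \<omega> $ v"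
      unfolding split[OF \<open>\<omega> \<in> space M\<close>]
      by (intro sum.cong) (auto simp: C_def indicator_def)
  qed
  finally show ?thesis .
qed

text \<open>With the coordinate process in place of \<open>w\<close>, the closed loop becomes a function of the mode path.\<close>

lemma closed_loop_path:
  "closed_loop D \<kappa> w z0 t \<omega> = closed_loop D \<kappa> (\<lambda>k h. h k) z0 t (\<lambda>k. w k \<omega>)"
  by (induction t) simp_all

text \<open>Causality: this supplies the dependence on finite histories that
  \<open>integrable_history\<close> and \<open>markov_chain_history\<close> ask for.\<close>

lemma closed_loop_cong:
  assumes "\<And>k. k \<le> t \<Longrightarrow> h k = h' k"
  shows "closed_loop D \<kappa> (\<lambda>k h. h k) z0 t h = closed_loop D \<kappa> (\<lambda>k h. h k) z0 t h'"
  using assms by (induction t) simp_all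

text \<open>The confidence update ignores state, input and mode, so the levels stored in the state
  are the deterministic ones in \<open>coverage\<close>.\<close>

lemma closed_loop_conf:
  "fst (snd (snd (closed_loop D \<kappa> w (x0, s0, \<beta>0, w0) t \<omega>))) = (conf_dyn D ^^ t) \<beta>0"
proof (induction t)
  case (Suc t)
  obtain x s b v where "closed_loop D \<kappa> w (x0, s0, \<beta>0, w0) t \<omega> = (x, s, b, v)"
    by (metis prod_cases4)
  then show ?case using Suc by simp
qed simp

text \<open>At time 0 the state carries the prescribed initial mode instead; every later state
  stores the mode that produced it.\<close>

lemma closed_loop_mode:
  assumes "0 < t"
  shows "snd (snd (snd (closed_loop D \<kappa> w z0 t \<omega>))) = w t \<omega>"
proof -
  obtain k where t: "t = Suc k" using assms gr0_implies_Suc by blast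
  obtain x s b v where "closed_loop D \<kappa> w z0 k \<omega> = (x, s, b, v)"
    by (metis prod_cases4)
  then show ?thesis by (simp add: t)
qed

lemma closed_loop_invariant:
  assumes "robust_pos_invariant D \<kappa> R" "z0 \<in> R"
  shows "closed_loop D \<kappa> w z0 t \<omega> \<in> R"
  using assms by (induction t) (auto simp: robust_pos_invariant_def)

theorem mainTheorem5:
  fixes D :: "('nx::finite, 'nu::finite, 'ns::finite, 'd::finite) mpc_data"
    and N :: nat
    and \<kappa> :: "('nx, 'ns, 'd) aug \<Rightarrow> real^'nu"
    and M :: "'a measure"
    and w :: "nat \<Rightarrow> 'a \<Rightarrow> 'd"
    and P :: "real^'d^'d"
    and Xbar :: "(real^'nx) set"
    and Zbar :: "('nx, 'ns, 'd) aug set"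
    and x0 :: "real^'nx" and s0 :: "real^'ns" and \<beta>0 :: "nat \<Rightarrow> real" and w0 :: 'd
  assumes "wf_mpc D"
    and "0 < N"
    and "mpc_law D N \<kappa>"
    and "compact Xbar" and "0 \<in> Xbar"
    and "Zbar = Xbar \<times> learner_states D \<times> conf_set D \<times> UNIV"
    and "Zbar \<subseteq> opt_dom D N"
    and "robust_pos_invariant D \<kappa> Zbar"
    and i: "\<forall>z\<in>aug_space D. bellman D (terminal_value D) z \<le> terminal_value D z"
    and ii: "\<exists>c>0. \<forall>(x, s, \<beta>, v)\<in>opt_dom D N. \<forall>u\<in>feasible_inputs D (x, s, \<beta>, v).
               c * (norm x)\<^sup>2 \<le> stage_cost D x u v"
    and iii: "locally_bounded_on aug_topology Zbar (opt_value D N)"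
    and "(x0, s0, \<beta>0, w0) \<in> Zbar"
    and "markov_chain M w P"
    and "AE \<omega> in M. w 0 \<omega> = w0"
    and "coverage D M P (\<lambda>t. (conf_dyn D ^^ t) \<beta>0) (closed_loop D \<kappa> w (x0, s0, \<beta>0, w0))"
    and "\<forall>i\<in>{0..n_con D}. summable (\<lambda>t. (conf_dyn D ^^ t) \<beta>0 i)"
  shows "(\<lambda>t. \<integral>\<omega>. (norm (fst (closed_loop D \<kappa> w (x0, s0, \<beta>0, w0) t \<omega>)))\<^sup>2 \<partial>M) \<longlonglongrightarrow> 0"
proof -
  interpret prob_space M using \<open>markov_chain M w P\<close> by (simp add: markov_chain_def)
  have ps: "prob_space M" by unfold_locales
  have meas: "w k \<in> measurable M (count_space UNIV)" for k
    using \<open>markov_chain M w P\<close> by (simp add: markov_chain_def)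
  obtain c where c: "c > 0"
    "\<And>x s b v u. (x, s, b, v) \<in> opt_dom D N \<Longrightarrow> u \<in> feasible_inputs D (x, s, b, v)
      \<Longrightarrow> c * (norm x)\<^sup>2 \<le> stage_cost D x u v"
    using ii by fast
  define z0 where "z0 = (x0, s0, \<beta>0, w0)"
  define \<beta> where "\<beta> t = (conf_dyn D ^^ t) \<beta>0 0" for t
  define Z where "Z t h = closed_loop D \<kappa> (\<lambda>k h. h k) z0 t h" for t h
  \<comment> \<open>\<open>V\<close> is evaluated only on \<open>Zbar\<close>, where the optimal
    cost is finite, so the value of \<open>real_of_ereal\<close> at infinity does not
    intervene.\<close>
  define V where "V z = real_of_ereal (opt_value D N z)" for z
  \<comment> \<open>Coverage by the ambiguity set of the cost, index 0, which is the one entering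
    \<open>bellman_cost\<close>.\<close>
  define Good where "Good z \<longleftrightarrow> (case z of (x, s, b, v) \<Rightarrow> P $ v \<in> amb D (b 0) s v)" for z :: "('nx, 'ns, 'd) aug"
  define W where "W \<omega> = (\<lambda>k. w k \<omega>)" for \<omega>
  have ZZbar: "Z t h \<in> Zbar" for t h
    unfolding Z_def z0_def by (rule closed_loop_invariant) fact+
  have loop: "closed_loop D \<kappa> w (x0, s0, \<beta>0, w0) t \<omega> = Z t (W \<omega>)" for t \<omega>
    unfolding Z_def W_def z0_def by (rule closed_loop_path)
  have Zcong: "Z t h = Z t h'" if "\<And>k. k \<le> t \<Longrightarrow> h k = h' k" for t h h'
    unfolding Z_def by (rule closed_loop_cong) (rule that)
  have hist_int: "integrable M (\<lambda>\<omega>. F (W \<omega>))"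
    if "\<And>h h'. (\<And>k. k \<le> t \<Longrightarrow> h k = h' k) \<Longrightarrow> F h = F h'" for F :: "_ \<Rightarrow> real" and t
    unfolding W_def by (rule integrable_history[OF ps meas that])
  have V0: "0 \<le> V z" if "z \<in> Zbar" for z
    unfolding V_def using that \<open>Zbar \<subseteq> opt_dom D N\<close>
    by (intro real_of_ereal_pos opt_value_nonneg[OF \<open>wf_mpc D\<close>]) (auto simp: opt_dom_def)
  have drift: "c * (norm (fst z))\<^sup>2 + (\<Sum>v\<in>UNIV. P $ snd (snd (snd z)) $ v * V (aug_dyn D z (\<kappa> z) v)) \<le> V z"
    if "z \<in> Zbar" "Good z" for z
  proof -
    obtain x s b v0 where z: "z = (x, s, b, v0)" by (cases z)
    have zd: "z \<in> opt_dom D N" using that \<open>Zbar \<subseteq> opt_dom D N\<close> by blast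
    have "\<kappa> z \<in> feasible_inputs D z"
      using \<open>mpc_law D N \<kappa>\<close> zd by (auto simp: mpc_law_def is_arg_min_def)
    then have "c * (norm x)\<^sup>2 \<le> stage_cost D x (\<kappa> z) v0"
      using c(2) zd z by blast
    moreover have "P $ v0 \<in> amb D (b 0) s v0" using that(2) by (simp add: Good_def z)
    ultimately show ?thesis
      using opt_value_drift[OF \<open>wf_mpc D\<close> _ \<open>0 < N\<close> \<open>mpc_law D N \<kappa>\<close> z zd, of "P $ v0"] i
      by (simp add: V_def z del: aug_dyn.simps)
  qed
  obtain R where R: "\<And>x. x \<in> Xbar \<Longrightarrow> norm x \<le> R"
    using compact_imp_bounded[OF \<open>compact Xbar\<close>] by (auto simp: bounded_iff)
  have Zle: "(norm (fst (Z t h)))\<^sup>2 \<le> R\<^sup>2" for t h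
    using ZZbar[of t h] R \<open>Zbar = _\<close> by (intro power_mono) auto
  have \<beta>0: "0 \<le> \<beta> t" for t
  proof -
    \<comment> \<open>The confidence vector is the same along all mode paths, so an arbitrary path
      will do.\<close>
    have "fst (snd (snd (Z t undefined))) \<in> conf_set D"
      using ZZbar[of t undefined] \<open>Zbar = _\<close> by auto
    then show ?thesis
      by (auto simp: Z_def z0_def closed_loop_conf \<beta>_def conf_set_def PiE_iff)
  qed
  have sum\<beta>: "summable \<beta>"
    using \<open>\<forall>i\<in>{0..n_con D}. summable _\<close> by (simp add: \<beta>_def[abs_def])
  have cover: "(\<integral>\<omega>. of_bool (\<not> Good (Z t (W \<omega>))) \<partial>M) \<le> \<beta> t" for t
  proof -
    define S where "S = {\<omega> \<in> space M. Good (Z t (W \<omega>))}"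
    \<comment> \<open>Measurability comes from the dependence on finitely many modes, not from
      regularity of the ambiguity sets or of \<open>\<kappa>\<close>.\<close>
    have ms: "(\<lambda>\<omega>. Good (Z t (W \<omega>))) \<in> measurable M (count_space UNIV)"
      unfolding W_def using Zcong[of t] by (intro measurable_history[OF meas, where t=t]) metis
    then have S: "S \<in> sets M" unfolding S_def by measurable
    have "(case Z t h of (x, s, b, v) \<Rightarrow> P $ v \<in> amb D (\<beta> t) s v) \<longleftrightarrow> Good (Z t h)" for h
      using closed_loop_conf[of D \<kappa> "\<lambda>k h. h k" x0 s0 \<beta>0 w0 t h]
      by (cases "Z t h") (auto simp: Good_def Z_def z0_def \<beta>_def)
    moreover have "1 - \<beta> t
        \<le> measure M {\<omega> \<in> space M. case Z t (W \<omega>) of (x, s, b, v) \<Rightarrow> P $ v \<in> amb D (\<beta> t) s v}"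
      using \<open>coverage D M P _ _\<close> unfolding coverage_def loop \<beta>_def by auto
    ultimately have "1 - \<beta> t \<le> measure M S"
      by (simp add: S_def)
    moreover have "(\<integral>\<omega>. of_bool (\<not> Good (Z t (W \<omega>))) \<partial>M) = (\<integral>\<omega>. (indicator (space M - S) \<omega> :: real) \<partial>M)"
      by (intro Bochner_Integration.integral_cong) (auto simp: S_def indicator_def)
    moreover have "(\<integral>\<omega>. indicator (space M - S) \<omega> \<partial>M) = 1 - measure M S"
      using S by (simp add: prob_compl Int_absorb1)
    ultimately show ?thesis by linarith
  qed

  \<comment> \<open>Expectations restricted to uninterrupted coverage from time \<open>T\<close>
    on\<close>
  define I where "I T t h = (of_bool (\<forall>k\<in>{T..t}. Good (Z k h)) :: real)" for T t h
  define a where "a T t = (\<integral>\<omega>. I T t (W \<omega>) * (norm (fst (Z t (W \<omega>))))\<^sup>2 \<partial>M)" for T t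
  define b where "b T t = (\<integral>\<omega>. I T t (W \<omega>) * V (Z t (W \<omega>)) \<partial>M)" for T t
  have Icong: "I T t h = I T t h'" if "\<And>k. k \<le> t \<Longrightarrow> h k = h' k" for T t h h'
  proof -
    have "Z k h = Z k h'" if "k \<le> t" for k
      using that \<open>\<And>k. k \<le> t \<Longrightarrow> h k = h' k\<close> by (intro Zcong) auto
    then show ?thesis by (auto simp: I_def)
  qed
  have inta: "integrable M (\<lambda>\<omega>. I T t (W \<omega>) * (norm (fst (Z t (W \<omega>))))\<^sup>2)" for T t
    using Zcong[of t] Icong[of t] by (intro hist_int[of t]) metis
  have intb: "integrable M (\<lambda>\<omega>. I T t (W \<omega>) * V (Z t (W \<omega>)))" for T t
    using Zcong[of t] Icong[of t] by (intro hist_int[of t]) metis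
  have a0: "0 \<le> a T t" for T t
    unfolding a_def by (intro Bochner_Integration.integral_nonneg) (simp add: I_def)
  have b0: "0 \<le> b T t" for T t
    unfolding b_def by (intro Bochner_Integration.integral_nonneg) (simp add: I_def V0 ZZbar)
  \<comment> \<open>Replacing the indicator at \<open>Suc t\<close> by the larger one at
    \<open>t\<close> leaves the next mode as the only dependence on time \<open>Suc t\<close>. The
    Markov property then puts the row of \<open>P\<close> in its place, and \<open>drift\<close>
    applies wherever the indicator is 1.\<close>
  have descent: "b T (Suc t) \<le> b T t - c * a T t" if "0 < t" "T \<le> t" for T t
  proof -
    define Zn where "Zn h v = aug_dyn D (Z t h) (\<kappa> (Z t h)) v" for h v
    have Zncong: "I T t h * V (Zn h v) = I T t h' * V (Zn h' v)" if "\<And>k. k \<le> t \<Longrightarrow> h k = h' k" for h h' v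
      unfolding Zn_def using Zcong[of t h h'] Icong[of t h h'] that by metis
    have ZSuc: "Z (Suc t) h = Zn h (h (Suc t))" for h
      by (simp add: Zn_def Z_def)
    have intv: "integrable M (\<lambda>\<omega>. I T t (W \<omega>) * V (Zn (W \<omega>) v) * of_bool (w (Suc t) \<omega> = v))" for v
    proof -
      have "integrable M (\<lambda>\<omega>. (\<lambda>h. I T t h * V (Zn h v) * of_bool (h (Suc t) = v)) (W \<omega>))"
      proof (rule hist_int[of "Suc t"])
        fix h h' :: "nat \<Rightarrow> 'd" assume "\<And>k. k \<le> Suc t \<Longrightarrow> h k = h' k"
        then show "I T t h * V (Zn h v) * of_bool (h (Suc t) = v) = I T t h' * V (Zn h' v) * of_bool (h' (Suc t) = v)"
          using Zncong[of h h' v] by simp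
      qed
      then show ?thesis by (simp add: W_def)
    qed
    have intp: "integrable M (\<lambda>\<omega>. I T t (W \<omega>) * V (Zn (W \<omega>) v) * P $ w t \<omega> $ v)" for v
    proof -
      have "integrable M (\<lambda>\<omega>. (\<lambda>h. I T t h * V (Zn h v) * P $ h t $ v) (W \<omega>))"
      proof (rule hist_int[of t])
        fix h h' :: "nat \<Rightarrow> 'd" assume "\<And>k. k \<le> t \<Longrightarrow> h k = h' k"
        then show "I T t h * V (Zn h v) * P $ h t $ v = I T t h' * V (Zn h' v) * P $ h' t $ v"
          using Zncong[of h h' v] by simp
      qed
      then show ?thesis by (simp add: W_def)
    qed
    \<comment> \<open>Splitting over the value \<open>v\<close> of the next mode makes each factor
      other than \<open>of_bool\<close> a function of the history up to \<open>t\<close>.\<close>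
    have "b T (Suc t) \<le> (\<integral>\<omega>. (\<Sum>v\<in>UNIV. I T t (W \<omega>) * V (Zn (W \<omega>) v) * of_bool (w (Suc t) \<omega> = v)) \<partial>M)"
      unfolding b_def
    proof (intro integral_mono intb Bochner_Integration.integrable_sum intv)
      fix \<omega>
      have "I T (Suc t) (W \<omega>) * V (Z (Suc t) (W \<omega>)) \<le> I T t (W \<omega>) * V (Z (Suc t) (W \<omega>))"
        by (intro mult_right_mono V0 ZZbar) (auto simp: I_def)
      also have "\<dots> = (\<Sum>v\<in>UNIV. I T t (W \<omega>) * V (Zn (W \<omega>) v) * of_bool (w (Suc t) \<omega> = v))"
        by (simp add: ZSuc W_def of_bool_def if_distrib cong: if_cong)
      finally show "I T (Suc t) (W \<omega>) * V (Z (Suc t) (W \<omega>))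
        \<le> (\<Sum>v\<in>UNIV. I T t (W \<omega>) * V (Zn (W \<omega>) v) * of_bool (w (Suc t) \<omega> = v))" .
    qed
    also have "\<dots> = (\<Sum>v\<in>UNIV. \<integral>\<omega>. I T t (W \<omega>) * V (Zn (W \<omega>) v) * of_bool (w (Suc t) \<omega> = v) \<partial>M)"
      by (intro Bochner_Integration.integral_sum intv)
    also have "\<dots> = (\<Sum>v\<in>UNIV. \<integral>\<omega>. I T t (W \<omega>) * V (Zn (W \<omega>) v) * P $ w t \<omega> $ v \<partial>M)"
      unfolding W_def
      by (intro sum.cong refl markov_chain_history[OF \<open>markov_chain M w P\<close>, where F="\<lambda>h. I T t h * V (Zn h _)"] Zncong)
    also have "\<dots> = (\<integral>\<omega>. (\<Sum>v\<in>UNIV. I T t (W \<omega>) * V (Zn (W \<omega>) v) * P $ w t \<omega> $ v) \<partial>M)"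
      by (intro Bochner_Integration.integral_sum[symmetric] intp)
    also have "\<dots> \<le> (\<integral>\<omega>. I T t (W \<omega>) * V (Z t (W \<omega>)) - c * (I T t (W \<omega>) * (norm (fst (Z t (W \<omega>))))\<^sup>2) \<partial>M)"
    proof (intro integral_mono Bochner_Integration.integrable_sum intp
        Bochner_Integration.integrable_diff intb integrable_mult_right inta)
      fix \<omega>
      define z where "z = Z t (W \<omega>)"
      have mode: "snd (snd (snd z)) = w t \<omega>"
        unfolding z_def Z_def by (simp add: closed_loop_mode[OF \<open>0 < t\<close>] W_def)
      have "(\<Sum>v\<in>UNIV. V (Zn (W \<omega>) v) * P $ w t \<omega> $ v) \<le> V z - c * (norm (fst z))\<^sup>2" if "Good z"
        using drift[of z] ZZbar[of t "W \<omega>"] that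
        by (simp add: z_def[symmetric] Zn_def mode mult.commute algebra_simps)
      moreover have "I T t (W \<omega>) = 0" if "\<not> Good z"
        using that \<open>T \<le> t\<close> by (auto simp: I_def z_def)
      ultimately show "(\<Sum>v\<in>UNIV. I T t (W \<omega>) * V (Zn (W \<omega>) v) * P $ w t \<omega> $ v)
        \<le> I T t (W \<omega>) * V (Z t (W \<omega>)) - c * (I T t (W \<omega>) * (norm (fst (Z t (W \<omega>))))\<^sup>2)"
        by (cases "Good z") (auto simp: I_def z_def)
    qed
    also have "\<dots> = b T t - c * a T t"
      unfolding b_def a_def using inta intb by simp
    finally show ?thesis .
  qed
  \<comment> \<open>\<open>T > 0\<close>, since at time 0 the mode of \<open>z\<^sub>0\<close> agrees with \<open>w 0\<close> only almost surely\<close>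
  have aT: "a T \<longlonglongrightarrow> 0" if "0 < T" for T
  proof -
    \<comment> \<open>Telescoping \<open>descent\<close> and dropping the nonnegative last term
      bounds all partial sums by \<open>b T T / c\<close>, so the series converges and its terms
      tend to 0.\<close>
    have bnd: "c * (\<Sum>k<n. a T (k + T)) \<le> b T T - b T (n + T)" for n
    proof (induction n)
      case (Suc n)
      then show ?case using descent[of "n + T" T] that by (simp add: distrib_left)
    qed simp
    have "(\<Sum>k<n. a T (k + T)) \<le> b T T / c" for n
      using bnd[of n] b0[of T "n + T"] c(1) by (simp add: field_simps)
    then have "summable (\<lambda>k. a T (k + T))"
      using a0 by (intro summableI_nonneg_bounded) auto
    then show ?thesis
      using summable_LIMSEQ_zero LIMSEQ_offset by blast
  qed

  \<comment> \<open>Removal of the restriction by a union bound\<close>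
  define e where "e t = (\<integral>\<omega>. (norm (fst (Z t (W \<omega>))))\<^sup>2 \<partial>M)" for t
  have e0: "0 \<le> e t" for t unfolding e_def by simp
  have ele: "e t \<le> a T t + R\<^sup>2 * (\<Sum>k. \<beta> (k + T))" if "T \<le> t" for T t
  proof -
    have intG: "integrable M (\<lambda>\<omega>. of_bool (\<not> Good (Z k (W \<omega>))) :: real)" for k
      using Zcong[of k] by (intro hist_int[of k]) metis
    \<comment> \<open>Pointwise union bound: if coverage fails at some time in
      \<open>{T..t}\<close>, the number of failures is at least 1 and the squared norm is at most
      \<open>R\<^sup>2\<close>.\<close>
    have "e t \<le> (\<integral>\<omega>. I T t (W \<omega>) * (norm (fst (Z t (W \<omega>))))\<^sup>2
        + R\<^sup>2 * (\<Sum>k\<in>{T..t}. of_bool (\<not> Good (Z k (W \<omega>)))) \<partial>M)"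
      unfolding e_def
    proof (intro integral_mono Bochner_Integration.integrable_add inta integrable_mult_right
        Bochner_Integration.integrable_sum intG)
      show "integrable M (\<lambda>\<omega>. (norm (fst (Z t (W \<omega>))))\<^sup>2)"
        using Zcong[of t] by (intro hist_int[of t]) metis
      fix \<omega>
      define S where "S = (\<Sum>k\<in>{T..t}. of_bool (\<not> Good (Z k (W \<omega>))) :: real)"
      have S0: "0 \<le> S" unfolding S_def by (intro sum_nonneg) simp
      show "(norm (fst (Z t (W \<omega>))))\<^sup>2 \<le> I T t (W \<omega>) * (norm (fst (Z t (W \<omega>))))\<^sup>2
        + R\<^sup>2 * (\<Sum>k\<in>{T..t}. of_bool (\<not> Good (Z k (W \<omega>))))"
      proof (cases "\<forall>k\<in>{T..t}. Good (Z k (W \<omega>))")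
        case True
        then show ?thesis using S0 by (simp add: I_def)
      next
        case False
        then obtain k where k: "k \<in> {T..t}" "\<not> Good (Z k (W \<omega>))" by blast
        have "1 \<le> S"
          unfolding S_def using member_le_sum[OF k(1), of "\<lambda>k. of_bool (\<not> Good (Z k (W \<omega>))) :: real"] k(2) by simp
        then have "R\<^sup>2 * 1 \<le> R\<^sup>2 * S" by (intro mult_left_mono) auto
        then show ?thesis using Zle[of t "W \<omega>"] by (auto simp: I_def S_def)
      qed
    qed
    also have "\<dots> = a T t + R\<^sup>2 * (\<Sum>k\<in>{T..t}. \<integral>\<omega>. of_bool (\<not> Good (Z k (W \<omega>))) \<partial>M)"
      unfolding a_def using inta intG by (simp add: Bochner_Integration.integral_sum del: sum_of_bool_eq)
    also have "\<dots> \<le> a T t + R\<^sup>2 * (\<Sum>k\<in>{T..t}. \<beta> k)"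
      by (intro add_left_mono mult_left_mono sum_mono cover) simp
    also have "(\<Sum>k\<in>{T..t}. \<beta> k) = (\<Sum>k\<in>{0..t - T}. \<beta> (k + T))"
      using that sum.shift_bounds_cl_nat_ivl[of \<beta> 0 T "t - T"] by simp
    also have "\<dots> \<le> (\<Sum>k. \<beta> (k + T))"
      using sum\<beta> \<beta>0 by (intro sum_le_suminf) (auto simp: summable_iff_shift)
    finally show ?thesis by (simp add: mult_left_mono)
  qed
  have tail: "(\<lambda>T. R\<^sup>2 * (\<Sum>k. \<beta> (k + T))) \<longlonglongrightarrow> 0"
    using tendsto_mult_left[OF suminf_exist_split2[OF sum\<beta>], of "R\<^sup>2"] by simp
  have "e \<longlonglongrightarrow> 0"
  proof (rule LIMSEQ_I)
    fix r :: real assume "0 < r"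
    \<comment> \<open>The order of choices matters: \<open>T\<close> is fixed first to make the tail
      small, uniformly in \<open>t\<close>; only then does \<open>t\<close> grow, since
      \<open>aT\<close> is a limit for fixed \<open>T\<close>.\<close>
    have "eventually (\<lambda>T. R\<^sup>2 * (\<Sum>k. \<beta> (k + T)) < r / 2 \<and> 0 < T) sequentially"
      using \<open>0 < r\<close> by (intro eventually_conj order_tendstoD(2)[OF tail] eventually_gt_at_top) simp
    then obtain T where T: "R\<^sup>2 * (\<Sum>k. \<beta> (k + T)) < r / 2" "0 < T"
      using eventually_happens sequentially_bot by blast
    have "eventually (\<lambda>t. a T t < r / 2 \<and> T \<le> t) sequentially"
      using \<open>0 < r\<close>
      by (intro eventually_conj order_tendstoD(2)[OF aT[OF T(2)]] eventually_ge_at_top) simp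
    then obtain n where n: "\<And>t. n \<le> t \<Longrightarrow> a T t < r / 2 \<and> T \<le> t"
      by (auto simp: eventually_sequentially)
    have "norm (e t - 0) < r" if "n \<le> t" for t
      using n[OF that] ele[of T t] T(1) e0[of t] by auto
    then show "\<exists>n. \<forall>t\<ge>n. norm (e t - 0) < r" by blast
  qed
  then show ?thesis unfolding loop e_def .
qed

end
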